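(* Let $n \in \mathbb{N}$, $n \geq 1$. For every collection $A_1, \ldots, A_n$ of $n$ bounded Borel subsets of $\mathbb{R}^n$ of positive Lebesgue measure, there exists a hyperplane $H$ in $\mathbb{R}^n$ such that for each $1 \leq i \leq n$, $H$ bisects $A_i$ and $H \cap \overline{A_i} \neq \emptyset$.
   Context: A hyperplane in $\mathbb{R}^n$ means an $(n-1)$-dimensional affine hyperplane $H = \{x \in \mathbb{R}^n : \langle u, x\rangle = c\}$, where $u \in \mathbb{R}^n$ with $|u| = 1$, $c \geq 0$, and $\langle\cdot,\cdot\rangle$ is the standard inner product. Its two open half-spaces are $H^+ = \{x \in \mathbb{R}^n: \langle u,x\rangle > c\}$ and $H^- = \{x \in \mathbb{R}^n : \langle u,x\rangle < c\}$. Writing $\lambda$ for $n$-dimensional Lebesgue measure, the hyperplane $H$ bisects a bounded Borel set $A \subset \mathbb{R}^n$ if $\lambda(A \cap H^+) = \lambda(A \cap H^-) = \lambda(A)/2$. $\overline{A}$ denotes the closure of $A$. *)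

theory Defs
  imports "HOL-Analysis.Analysis"
begin

definition hyperplane :: "'a::euclidean_space \<Rightarrow> real \<Rightarrow> 'a set" where
  "hyperplane u c = {x. u \<bullet> x = c}"

definition pos_halfspace :: "'a::euclidean_space \<Rightarrow> real \<Rightarrow> 'a set" where
  "pos_halfspace u c = {x. u \<bullet> x > c}"

definition neg_halfspace :: "'a::euclidean_space \<Rightarrow> real \<Rightarrow> 'a set" where
  "neg_halfspace u c = {x. u \<bullet> x < c}"

text \<open>The real-valued \<^const>\<open>measure\<close> sends infinite measure to 0, so this notion
  is meaningful only for sets of finite measure, such as bounded Borel sets.
  Replacing \<open>(u, c)\<close> by \<open>(- u, - c)\<close> swaps the half-spaces, so whether a hyperplane
  bisects a set does not depend on the pair chosen to describe it.\<close>

definition bisects :: "'a::euclidean_space \<Rightarrow> real \<Rightarrow> 'a set \<Rightarrow> bool" where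
  "bisects u c A \<longleftrightarrow>
     measure lebesgue (A \<inter> pos_halfspace u c) = measure lebesgue A / 2 \<and>
     measure lebesgue (A \<inter> neg_halfspace u c) = measure lebesgue A / 2"

end

theory Submission
  imports Defs "HOL-Homology.Invariance_of_Domain"
begin

text \<open>
Let \<open>n\<close> be the dimension. For a set \<open>E\<close>, the measure of \<open>E\<close> on the positive side of the
hyperplane \<open>u \<bullet> x = c\<close> minus that on the negative side is an odd and continuous function of
\<open>(u, c) \<noteq> 0\<close>, and it vanishes exactly when the hyperplane bisects \<open>E\<close>. The unit sphere of the
parameters \<open>(u, c)\<close> has dimension \<open>n\<close>, so by the Borsuk-Ulam theorem \<open>n\<close> such functions have a
common zero. This is the classical ham sandwich theorem; a hyperplane found in this way may run
through a gap of some \<open>A i\<close> without touching its closure.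

To force contact, a point \<open>a i\<close> is fixed in each \<open>A i\<close>, and the argument is applied not to \<open>A i\<close> but to
the sum of its measure and that of a ball of radius \<open>\<rho> k\<close> about \<open>a i\<close>, where \<open>\<rho> k\<close> tends
to 0. Let \<open>H\<close> be the limit of a convergent subsequence of the hyperplanes \<open>H k\<close> so obtained. It
bisects every \<open>A i\<close>. If it missed the closure of some \<open>A i\<close>, which is compact, then for large \<open>k\<close>
the hyperplane \<open>H k\<close> would divide \<open>A i\<close> exactly like \<open>H\<close>, hence equally, and would therefore have to
bisect the small ball as well; but \<open>a i\<close> has positive distance from \<open>H\<close>, so for large \<open>k\<close> the ball lies
on one side of \<open>H k\<close> (\<open>limit_hyperplane_meets_closure\<close>).

The Borsuk-Ulam theorem is derived from the theorem that odd self-maps of a sphere have odd degree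
(\<open>odd_nsphere_map_odd_degree\<close>), since a map that is not surjective has degree 0. That theorem
is proved by induction on the dimension: an odd map is deformed until it respects the equator
(\<open>odd_sphere_map_deform_to_equator\<close>), and then its degree has the parity of the degree of its restriction
to the equator.
\<close>

section \<open>Deforming an odd map so that it respects the equator\<close>

text \<open>On a sphere in a subspace, homotopies are obtained as straight-line homotopies in the subspace
followed by radial projection, which is \<^const>\<open>sgn\<close>; the only obstruction is a segment that
passes through the origin.\<close>

lemma homotopic_sgn:
  fixes f g :: "'a::euclidean_space \<Rightarrow> 'b::euclidean_space"
  assumes T: "subspace T"
    and contf: "continuous_on S f" and contg: "continuous_on S g"
    and fim: "f \<in> S \<rightarrow> T" and gim: "g \<in> S \<rightarrow> T"
    and nz: "\<And>x. x \<in> S \<Longrightarrow> 0 \<notin> closed_segment (f x) (g x)"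
  shows "homotopic_with_canon (\<lambda>_. True) S (sphere 0 1 \<inter> T) (sgn \<circ> f) (sgn \<circ> g)"
proof (rule homotopic_with_compose_continuous_left)
  have "closed_segment (f x) (g x) \<subseteq> T - {0}" if "x \<in> S" for x
    using that closed_segment_subset [OF _ _ subspace_imp_convex [OF T]] fim gim nz by blast
  then show "homotopic_with_canon (\<lambda>_. True) S (T - {0}) f g"
    by (intro homotopic_with_linear contf contg) auto
  show "continuous_on (T - {0}) sgn"
    by (rule continuous_on_sgn) (auto intro: continuous_intros)
  show "sgn \<in> T - {0} \<rightarrow> sphere 0 1 \<inter> T"
    using T by (auto simp: norm_sgn sgn_div_norm subspace_scale)
qed

text \<open>The odd part of a Weierstrass approximation is at least as good, because taking odd parts does
not increase the supremum norm on a symmetric set.\<close>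

lemma odd_polynomial_approximation:
  fixes f :: "'a::euclidean_space \<Rightarrow> 'b::euclidean_space"
  assumes K: "compact K" and sym: "\<And>x. x \<in> K \<Longrightarrow> - x \<in> K"
    and contf: "continuous_on K f" and T: "subspace T" and fim: "f \<in> K \<rightarrow> T"
    and oddf: "\<And>x. x \<in> K \<Longrightarrow> f (- x) = - f x" and e: "e > 0"
  obtains q where "polynomial_function q" "q \<in> K \<rightarrow> T" "\<And>x. q (- x) = - q x"
    "\<And>x. x \<in> K \<Longrightarrow> norm (f x - q x) < e"
proof -
  obtain p where p: "polynomial_function p" "p ` K \<subseteq> T"
    and fp: "\<And>x. x \<in> K \<Longrightarrow> norm (f x - p x) < e"
    using Stone_Weierstrass_polynomial_function_subspace [OF K contf e T] fim by blast
  define q where "q x = (1/2) *\<^sub>R (p x - p (- x))" for x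
  show thesis
  proof
    have "polynomial_function (\<lambda>x. p (- x))"
      using polynomial_function_compose [OF polynomial_function_minus [OF polynomial_function_id] p(1)]
      by (simp add: o_def)
    then show "polynomial_function q"
      unfolding q_def using p(1) by (intro polynomial_function_cmul polynomial_function_diff)
    show "q \<in> K \<rightarrow> T"
      using p(2) sym T by (auto simp: q_def image_subset_iff intro!: subspace_scale subspace_diff)
    show "q (- x) = - q x" for x
      by (simp add: q_def algebra_simps)
    show "norm (f x - q x) < e" if x: "x \<in> K" for x
    proof -
      have "f x - q x = (1/2) *\<^sub>R (f x - p x) - (1/2) *\<^sub>R (f (- x) - p (- x))"
        using oddf [OF x] scaleR_half_double [of "f x"] by (simp add: q_def algebra_simps)
      also have "norm \<dots> \<le> 1/2 * norm (f x - p x) + 1/2 * norm (f (- x) - p (- x))"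
        by (rule order_trans [OF norm_triangle_ineq4]) simp
      also have "\<dots> < e"
        using fp [OF x] fp [OF sym [OF x]] by simp
      finally show ?thesis .
    qed
  qed
qed

text \<open>The reflection in the hyperplane orthogonal to \<open>d = p - e\<close> swaps the unit vectors \<open>p\<close> and \<open>e\<close>.
When \<open>d = 0\<close>, division by zero turns the defining formula into the identity, as it should be.\<close>

lemma unit_vectors_reflection:
  fixes p e :: "'a::euclidean_space"
  assumes T: "subspace T" and p: "p \<in> T" "norm p = 1" and e: "e \<in> T" "norm e = 1"
  obtains R where "linear R" "R \<in> T \<rightarrow> T" "\<And>x. norm (R x) = norm x" "\<And>x. R (R x) = x"
    "\<And>x. R x \<bullet> e = x \<bullet> p"
proof -
  define d where "d = p - e"
  define R where "R x = x - (2 * (x \<bullet> d) / (d \<bullet> d)) *\<^sub>R d" for x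
  have lin: "linear R"
    by (rule linearI) (simp_all add: R_def algebra_simps add_divide_distrib)
  have Rd: "R x \<bullet> d = - (x \<bullet> d)" for x
    by (cases "d = 0") (simp_all add: R_def inner_diff_left)
  have inv: "R (R x) = x" for x
    unfolding R_def [of "R x"] Rd by (simp add: R_def)
  have nrm: "norm (R x) = norm x" for x
  proof -
    have "R x \<bullet> R x = R x \<bullet> x - (2 * (x \<bullet> d) / (d \<bullet> d)) * (R x \<bullet> d)"
      by (simp add: R_def [of x] inner_diff_right)
    also have "\<dots> = x \<bullet> x"
      unfolding Rd by (simp add: R_def inner_diff_left inner_diff_right inner_commute)
    finally show ?thesis
      by (simp add: norm_eq_sqrt_inner)
  qed
  have "R x \<bullet> e = x \<bullet> p" for x
  proof (cases "d = 0")
    case True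
    then show ?thesis by (simp add: R_def d_def)
  next
    case False
    have pe: "p \<bullet> p = 1" "e \<bullet> e = 1"
      using p e by (simp_all add: norm_eq_sqrt_inner)
    have dd: "d \<bullet> d = - 2 * (d \<bullet> e)"
      by (simp add: d_def inner_diff_left inner_diff_right pe inner_commute)
    with False have "d \<bullet> e \<noteq> 0"
      by force
    then have "2 * (x \<bullet> d) / (d \<bullet> d) * (d \<bullet> e) = - (x \<bullet> d)"
      unfolding dd by (simp add: field_simps)
    then show ?thesis
      by (simp add: R_def inner_diff_left) (simp add: d_def inner_diff_right)
  qed
  moreover have "R \<in> T \<rightarrow> T"
    using T p e by (auto simp: R_def d_def intro!: subspace_diff subspace_scale)
  ultimately show thesis
    using that [of R] lin inv nrm by blast
qed

text \<open>An odd self-map of a sphere need not respect the equator, but up to a reflection it is homotopic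
to an odd map that does. The approximation \<open>P\<close> of \<open>F\<close> is smooth, so its restriction to the equator,
which has smaller dimension, misses some point \<open>p\<close> of the sphere, and by oddness it misses \<open>- p\<close> too.
The image of the equator can therefore be pushed, away from the two poles \<open>p\<close> and \<open>- p\<close>, into the
great sphere orthogonal to \<open>p\<close>, which the reflection that swaps \<open>p\<close> and \<open>e\<close> carries to the
equator.\<close>

lemma odd_sphere_map_deform_to_equator:
  fixes F :: "'a::euclidean_space \<Rightarrow> 'a"
  assumes T: "subspace T" and e: "e \<in> T" "norm e = 1"
    and contF: "continuous_on (sphere 0 1 \<inter> T) F"
    and Fim: "F \<in> sphere 0 1 \<inter> T \<rightarrow> sphere 0 1 \<inter> T"
    and oddF: "\<And>x. x \<in> sphere 0 1 \<inter> T \<Longrightarrow> F (- x) = - F x"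
  obtains R G where "linear R" "R \<in> sphere 0 1 \<inter> T \<rightarrow> sphere 0 1 \<inter> T" "\<And>x. R (R x) = x"
    "continuous_on (sphere 0 1 \<inter> T) G" "G \<in> sphere 0 1 \<inter> T \<rightarrow> sphere 0 1 \<inter> T"
    "\<And>x. x \<in> sphere 0 1 \<inter> T \<Longrightarrow> G (- x) = - G x"
    "\<And>x. x \<in> sphere 0 1 \<inter> T \<Longrightarrow> x \<bullet> e = 0 \<Longrightarrow> G x \<bullet> e = 0"
    "homotopic_with_canon (\<lambda>_. True) (sphere 0 1 \<inter> T) (sphere 0 1 \<inter> T) (R \<circ> F) G"
proof -
  define W where "W = sphere 0 1 \<inter> T"
  define S where "S = {x \<in> T. x \<bullet> e = 0}"
  have W: "compact W"
    unfolding W_def by (simp add: T closed_subspace compact_Int_closed)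
  have symW: "- x \<in> W" if "x \<in> W" for x
    using that T by (auto simp: W_def subspace_neg)
  have S: "subspace S" "S \<subseteq> T"
    using T by (auto simp: S_def subspace_def inner_add_left)
  have "e \<notin> S"
    using e by (auto simp: S_def)
  then have "dim S < dim T"
    using S T e dim_psubset [of S T] by (metis psubsetI span_eq_iff)
  obtain q where q: "polynomial_function q" "q \<in> W \<rightarrow> T" "\<And>x. q (- x) = - q x"
    and Fq: "\<And>x. x \<in> W \<Longrightarrow> norm (F x - q x) < 1"
    using odd_polynomial_approximation [OF W symW contF [folded W_def] T, of 1] Fim oddF
    by (auto simp: W_def)
  have q0: "q x \<noteq> 0" if "x \<in> W" for x
    using Fq [OF that] funcset_mem [OF Fim, of x] that by (auto simp: W_def)
  define P where "P = sgn \<circ> q"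
  have P: "P x \<in> W" if "x \<in> W" for x
    using q0 [OF that] subspace_scale [OF T funcset_mem [OF q(2) that]]
    by (simp add: P_def W_def norm_sgn sgn_div_norm)
  have oddP: "P (- x) = - P x" for x
    by (simp add: P_def q(3) sgn_minus)
  have contq: "continuous_on W q"
    using q(1) by (simp add: differentiable_imp_continuous_on differentiable_on_polynomial_function)
  then have contP: "continuous_on W P"
    unfolding P_def o_def using q0 by (auto intro: continuous_on_sgn)
  have diffq: "q differentiable_on sphere 0 1 \<inter> S"
    using q(1) by (rule differentiable_on_polynomial_function)
  have "q x \<noteq> 0" if "x \<in> sphere 0 1 \<inter> S" for x
    using that q0 S(2) by (auto simp: W_def)
  then have "(\<lambda>x. q x /\<^sub>R norm (q x)) differentiable_on sphere 0 1 \<inter> S"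
    by (fastforce intro: derivative_intros diffq differentiable_on_compose [OF diffq])
  then have "P differentiable_on sphere 0 1 \<inter> S"
    by (simp add: P_def o_def sgn_div_norm)
  then have "P ` (sphere 0 1 \<inter> S) \<noteq> W"
    unfolding W_def using spheremap_lemma1 S T \<open>dim S < dim T\<close> by blast
  then obtain p where p: "p \<in> W" "p \<notin> P ` (sphere 0 1 \<inter> S)"
    using P S(2) W_def by blast
  have p1: "norm p = 1" "p \<in> T" "p \<bullet> p = 1"
    using p(1) by (auto simp: W_def norm_eq_sqrt_inner)
  have "P x \<noteq> - p" if "x \<in> sphere 0 1 \<inter> S" for x
  proof
    assume "P x = - p"
    then have "P (- x) = p"
      by (simp add: oddP)
    moreover have "- x \<in> sphere 0 1 \<inter> S"
      using that S(1) by (simp add: subspace_neg)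
    ultimately show False
      using p(2) by blast
  qed
  then have Pp: "P x \<noteq> p \<and> P x \<noteq> - p" if "x \<in> W" "x \<bullet> e = 0" for x
    using that p(2) by (auto simp: W_def S_def)
  \<comment> \<open>The push removes the whole \<open>p\<close>-component on the equator \<open>x \<bullet> e = 0\<close>, where \<open>P\<close> avoids the
    poles; the factor fades out towards \<open>x = e\<close> and \<open>x = - e\<close>, and being even it preserves oddness.\<close>
  define K where "K x = P x - ((1 - \<bar>x \<bullet> e\<bar>) * (P x \<bullet> p)) *\<^sub>R p" for x
  have K: "K x \<in> T" if "x \<in> W" for x
    using P [OF that] p1 T by (auto simp: K_def W_def intro!: subspace_diff subspace_scale)
  have contK: "continuous_on W K"
    unfolding K_def by (intro continuous_intros contP)
  have oddK: "K (- x) = - K x" for x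
    by (simp add: K_def oddP)
  have segK: "0 \<notin> closed_segment (P x) (K x)" if x: "x \<in> W" for x
  proof
    assume "0 \<in> closed_segment (P x) (K x)"
    then obtain t where t: "0 \<le> t" "t \<le> 1" and eq0: "(1 - t) *\<^sub>R P x + t *\<^sub>R K x = 0"
      by (auto simp: in_segment)
    \<comment> \<open>At a zero of the segment all of \<open>P x\<close> has been removed, which forces \<open>s = 1\<close>, hence
      \<open>x \<bullet> e = 0\<close> and \<open>P x = p\<close> or \<open>P x = - p\<close>.\<close>
    define s where "s = t * (1 - \<bar>x \<bullet> e\<bar>)"
    have Px: "P x = (s * (P x \<bullet> p)) *\<^sub>R p"
      using eq0 by (simp add: K_def s_def algebra_simps)
    have nP: "norm (P x) = 1"
      using P [OF x] by (simp add: W_def)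
    have xe: "\<bar>x \<bullet> e\<bar> \<le> 1"
      using Cauchy_Schwarz_ineq2 [of x e] x e by (simp add: W_def)
    have s: "0 \<le> s" "s \<le> 1 - \<bar>x \<bullet> e\<bar>"
      using t xe by (auto simp: s_def mult_left_le_one_le)
    have Pp1: "\<bar>P x \<bullet> p\<bar> \<le> 1"
      using Cauchy_Schwarz_ineq2 [of "P x" p] nP p1 by simp
    have "1 = s * \<bar>P x \<bullet> p\<bar>"
      using arg_cong [OF Px, of norm] nP p1 s by (simp add: abs_mult)
    also have "\<dots> \<le> s"
      using s(1) Pp1 by (simp add: mult_left_le)
    finally have "1 \<le> s" .
    with s have "s = 1" "x \<bullet> e = 0"
      by auto
    with \<open>1 = s * \<bar>P x \<bullet> p\<bar>\<close> have "P x \<bullet> p = 1 \<or> P x \<bullet> p = - 1"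
      by auto
    with Px \<open>s = 1\<close> have "P x = p \<or> P x = - p"
      by (metis mult_1 scaleR_minus1_left scaleR_one)
    with Pp [OF x \<open>x \<bullet> e = 0\<close>] show False
      by blast
  qed
  obtain R where R: "linear R" "R \<in> T \<rightarrow> T" "\<And>x. norm (R x) = norm x" "\<And>x. R (R x) = x"
    and Re: "\<And>x. R x \<bullet> e = x \<bullet> p"
    using unit_vectors_reflection [OF T p1(2,1) e] by blast
  have contR: "continuous_on A R" for A
    using R(1) by (rule linear_continuous_on_compose [OF continuous_on_id])
  have RW: "R \<in> W \<rightarrow> W"
    using R(2,3) by (auto simp: W_def)
  define G where "G = R \<circ> (sgn \<circ> K)"
  have "homotopic_with_canon (\<lambda>_. True) W W (sgn \<circ> F) (sgn \<circ> q)"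
    unfolding W_def
  proof (rule homotopic_sgn [OF T contF contq [unfolded W_def]])
    fix x assume x: "x \<in> sphere 0 1 \<inter> T"
    have "norm (F x) = 1"
      using Fim x by auto
    then show "0 \<notin> closed_segment (F x) (q x)"
      using Fq [of x] x by (auto simp: W_def norm_minus_commute dest: segment_bound)
  qed (use Fim q(2) W_def in auto)
  moreover have "homotopic_with_canon (\<lambda>_. True) W W (sgn \<circ> P) (sgn \<circ> K)"
    unfolding W_def
    by (rule homotopic_sgn [OF T])
      (use contP contK P K segK in \<open>auto simp: W_def\<close>)
  moreover have "sgn \<circ> P = sgn \<circ> q"
  proof
    show "(sgn \<circ> P) x = (sgn \<circ> q) x" for x
      by (cases "q x = 0") (simp_all add: P_def sgn_div_norm)
  qed
  ultimately have "homotopic_with_canon (\<lambda>_. True) W W (sgn \<circ> F) (sgn \<circ> K)"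
    using homotopic_with_trans by metis
  then have "homotopic_with_canon (\<lambda>_. True) W W F (sgn \<circ> K)"
  proof (rule homotopic_with_eq)
    show "F x = (sgn \<circ> F) x" if "x \<in> topspace (top_of_set W)" for x
      using that funcset_mem [OF Fim, of x] by (simp add: W_def sgn_div_norm)
  qed auto
  then have hom: "homotopic_with_canon (\<lambda>_. True) W W (R \<circ> F) G"
    unfolding G_def using contR RW
    by (rule homotopic_with_compose_continuous_left)
  then have G: "continuous_on W G" "G \<in> W \<rightarrow> W"
    using homotopic_with_imp_continuous homotopic_with_imp_subset2 by blast+
  have oddG: "G (- x) = - G x" for x
    by (simp add: G_def oddK sgn_minus linear_neg [OF R(1)])
  have "G x \<bullet> e = 0" if "x \<bullet> e = 0" for x
    using that by (simp add: G_def Re K_def sgn_div_norm inner_diff_left p1(3))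
  then show thesis
    using that [of R G] R(1,4) RW G oddG hom unfolding W_def by blast
qed

section \<open>Odd maps have odd degree\<close>

text \<open>Degrees are defined for the spheres \<^const>\<open>nsphere\<close> of sequences, whereas smooth approximation and
negligible images belong to Euclidean spaces. An enumeration of an orthonormal basis identifies
the two by linear, hence odd, maps, and it matches the chain of coordinate spheres on one side with
a chain of unit spheres of subspaces on the other. Working inside one large Euclidean space lets
the dimension vary in an induction.\<close>

locale basis_enumeration =
  fixes b :: "nat \<Rightarrow> 'a::euclidean_space"
  assumes bij_b: "bij_betw b {..<DIM('a)} Basis"
begin

definition from_coords :: "(nat \<Rightarrow> real) \<Rightarrow> 'a" where
  "from_coords x = (\<Sum>i<DIM('a). x i *\<^sub>R b i)"

definition coords :: "'a \<Rightarrow> nat \<Rightarrow> real" where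
  "coords v i = (if i < DIM('a) then v \<bullet> b i else 0)"

definition coord_subspace :: "nat \<Rightarrow> 'a set" where
  "coord_subspace k = {v. \<forall>i. k < i \<longrightarrow> i < DIM('a) \<longrightarrow> v \<bullet> b i = 0}"

lemma b_in_Basis: "i < DIM('a) \<Longrightarrow> b i \<in> Basis"
  using bij_b by (auto simp: bij_betw_def)

lemma inner_b_b: "i < DIM('a) \<Longrightarrow> j < DIM('a) \<Longrightarrow> b i \<bullet> b j = (if i = j then 1 else 0)"
  using bij_b by (auto simp: inner_Basis b_in_Basis bij_betw_def inj_on_def)

lemma from_coords_inner_b: "j < DIM('a) \<Longrightarrow> from_coords x \<bullet> b j = x j"
  by (simp add: from_coords_def inner_sum_left inner_b_b if_distrib cong: if_cong)

lemma from_coords_coords [simp]: "from_coords (coords v) = v"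
proof -
  have "from_coords (coords v) = (\<Sum>i<DIM('a). (v \<bullet> b i) *\<^sub>R b i)"
    by (simp add: from_coords_def coords_def)
  also have "\<dots> = v"
    by (subst sum.reindex_bij_betw [OF bij_b, of "\<lambda>u. (v \<bullet> u) *\<^sub>R u"])
      (rule euclidean_representation)
  finally show ?thesis .
qed

lemma coords_from_coords: "(\<And>i. i \<ge> DIM('a) \<Longrightarrow> x i = 0) \<Longrightarrow> coords (from_coords x) = x"
  by (rule ext) (simp add: coords_def from_coords_inner_b)

lemma from_coords_uminus: "from_coords (\<lambda>i. - x i) = - from_coords x"
  by (simp add: from_coords_def sum_negf)

lemma coords_uminus: "coords (- v) = (\<lambda>i. - coords v i)"
  by (auto simp: coords_def)

lemma norm_eq_1_iff_coords:
  assumes "k < DIM('a)" "v \<in> coord_subspace k"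
  shows "norm v = 1 \<longleftrightarrow> (\<Sum>i\<le>k. (v \<bullet> b i)\<^sup>2) = 1"
proof -
  have "v \<bullet> v = (\<Sum>i<DIM('a). (v \<bullet> b i)\<^sup>2)"
    unfolding euclidean_inner [of v v] power2_eq_square
    by (rule sum.reindex_bij_betw [OF bij_b, symmetric])
  also have "\<dots> = (\<Sum>i\<le>k. (v \<bullet> b i)\<^sup>2)"
    using assms by (intro sum.mono_neutral_right) (auto simp: coord_subspace_def)
  finally show ?thesis
    by (simp add: norm_eq_1)
qed

lemma subspace_coord_subspace: "subspace (coord_subspace k)"
  by (auto simp: coord_subspace_def subspace_def inner_add_left)

lemma topspace_nsphere_iff:
  "x \<in> topspace (nsphere k) \<longleftrightarrow> (\<Sum>i\<le>k. (x i)\<^sup>2) = 1 \<and> (\<forall>i>k. x i = 0)"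
  by (auto simp: nsphere)

lemma coords_from_coords_nsphere:
  "k < DIM('a) \<Longrightarrow> x \<in> topspace (nsphere k) \<Longrightarrow> coords (from_coords x) = x"
  by (rule coords_from_coords) (auto simp: topspace_nsphere_iff)

lemma from_coords_in_sphere:
  assumes "k < DIM('a)" "x \<in> topspace (nsphere k)"
  shows "from_coords x \<in> sphere 0 1 \<inter> coord_subspace k"
proof -
  have "from_coords x \<in> coord_subspace k"
    using assms by (auto simp: coord_subspace_def from_coords_inner_b topspace_nsphere_iff)
  moreover from this have "norm (from_coords x) = 1"
    using assms by (simp add: norm_eq_1_iff_coords from_coords_inner_b topspace_nsphere_iff)
  ultimately show ?thesis
    by simp
qed

lemma coords_in_nsphere:
  assumes "k < DIM('a)" "v \<in> sphere 0 1 \<inter> coord_subspace k"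
  shows "coords v \<in> topspace (nsphere k)"
  using assms norm_eq_1_iff_coords [of k v]
  by (auto simp: topspace_nsphere_iff coords_def coord_subspace_def)

lemma continuous_map_from_coords:
  assumes "k < DIM('a)"
  shows "continuous_map (nsphere k) (top_of_set (sphere 0 1 \<inter> coord_subspace k)) from_coords"
proof -
  have "continuous_on A from_coords" for A
    unfolding from_coords_def
    by (intro continuous_intros continuous_on_subset [OF continuous_on_product_coordinates]) auto
  then show ?thesis
    using from_coords_in_sphere [OF assms]
    by (auto simp: continuous_map_in_subtopology nsphere euclidean_product_topology)
qed

lemma continuous_map_coords:
  assumes "k < DIM('a)"
  shows "continuous_map (top_of_set (sphere 0 1 \<inter> coord_subspace k)) (nsphere k) coords"
proof -
  have "continuous_on A (\<lambda>v. coords v i)" for A i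
    by (cases "i < DIM('a)") (auto simp: coords_def intro: continuous_intros)
  then have "continuous_on A coords" for A
    by (rule continuous_on_coordinatewise_then_product)
  then show ?thesis
    using coords_in_nsphere [OF assms]
    by (auto simp: continuous_map_in_subtopology nsphere euclidean_product_topology)
qed

lemma continuous_map_nsphere_conjugate:
  assumes "k < DIM('a)" "continuous_on (sphere 0 1 \<inter> coord_subspace k) F"
    "F \<in> sphere 0 1 \<inter> coord_subspace k \<rightarrow> sphere 0 1 \<inter> coord_subspace k"
  shows "continuous_map (nsphere k) (nsphere k) (coords \<circ> F \<circ> from_coords)"
  using assms
  by (intro continuous_map_compose [OF continuous_map_from_coords]
      continuous_map_compose [OF _ continuous_map_coords]) (auto simp: image_subset_iff)

text \<open>Borsuk's theorem on odd maps. If an odd map respects the equator, then its degree and that of its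
restriction to the equator have the same parity
(\<open>Borsuk_odd_mapping_degree_step\<close>). Every odd map can be brought into this form by
\<open>odd_sphere_map_deform_to_equator\<close>: the reflection is an involution and has odd degree, so
composition with it does not change the parity, and homotopy does not change the degree.
This gives the induction step.\<close>

theorem odd_nsphere_map_odd_degree:
  assumes "n < DIM('a)" "continuous_map (nsphere n) (nsphere n) f"
    and "\<And>x. x \<in> topspace (nsphere n) \<Longrightarrow> f (\<lambda>i. - x i) = (\<lambda>i. - f x i)"
  shows "odd (Brouwer_degree2 n f)"
  using assms
proof (induction n arbitrary: f)
  case 0
  \<comment> \<open>The sphere of dimension 0 consists of two antipodal points, so an odd self-map is an involution.\<close>
  have pm: "y = x \<or> y = (\<lambda>i. - x i)"
    if "x \<in> topspace (nsphere 0)" "y \<in> topspace (nsphere 0)" for x y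
  proof -
    have "(y 0)\<^sup>2 = (x 0)\<^sup>2"
      using that by (simp add: topspace_nsphere_iff)
    then have "y 0 = x 0 \<or> y 0 = - x 0"
      by (simp add: power2_eq_iff)
    moreover have "x i = 0 \<and> y i = 0" if "i > 0" for i
      using that \<open>x \<in> _\<close> \<open>y \<in> _\<close> by (simp add: topspace_nsphere_iff)
    ultimately have "(\<forall>i. y i = x i) \<or> (\<forall>i. y i = - x i)"
      by (metis gr_zeroI minus_zero)
    then show ?thesis
      by (auto simp: fun_eq_iff)
  qed
  have "(f \<circ> f) x = id x" if x: "x \<in> topspace (nsphere 0)" for x
  proof -
    have "f x \<in> topspace (nsphere 0)"
      using 0(2) x by (auto simp: continuous_map_def)
    from pm [OF x this] show ?thesis
      using 0(3) [OF x] by auto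
  qed
  then have "Brouwer_degree2 0 (f \<circ> f) = 1"
    using Brouwer_degree2_eq [of 0 "f \<circ> f" id] by simp
  then show ?case
    using Brouwer_degree2_compose [OF 0(2) 0(2)] by (metis even_mult_iff odd_one)
next
  case (Suc n)
  let ?k = "Suc n"
  let ?W = "sphere 0 1 \<inter> coord_subspace ?k"
  note k = Suc.prems(1)
  have fS: "f x \<in> topspace (nsphere ?k)" if "x \<in> topspace (nsphere ?k)" for x
    using Suc.prems(2) that by (auto simp: continuous_map_def)
  define F where "F = from_coords \<circ> f \<circ> coords"
  have "continuous_map (top_of_set ?W) (top_of_set ?W) F"
    unfolding F_def
    by (intro continuous_map_compose [OF continuous_map_coords [OF k]]
        continuous_map_compose [OF _ continuous_map_from_coords [OF k]] Suc.prems(2))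
  then have F: "continuous_on ?W F" "F \<in> ?W \<rightarrow> ?W"
    by (auto simp: continuous_map_in_subtopology)
  have oddF: "F (- v) = - F v" if "v \<in> ?W" for v
    using Suc.prems(3) [OF coords_in_nsphere [OF k that]]
    by (simp add: F_def coords_uminus from_coords_uminus)
  have e: "b ?k \<in> coord_subspace ?k" "norm (b ?k) = 1"
    using k by (auto simp: coord_subspace_def inner_b_b b_in_Basis)
  obtain R G where R: "linear R" "R \<in> ?W \<rightarrow> ?W" "\<And>v. R (R v) = v"
    and G: "continuous_on ?W G" "G \<in> ?W \<rightarrow> ?W" "\<And>v. v \<in> ?W \<Longrightarrow> G (- v) = - G v"
    and Geq: "\<And>v. v \<in> ?W \<Longrightarrow> v \<bullet> b ?k = 0 \<Longrightarrow> G v \<bullet> b ?k = 0"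
    and hom: "homotopic_with_canon (\<lambda>_. True) ?W ?W (R \<circ> F) G"
    by (rule odd_sphere_map_deform_to_equator [OF subspace_coord_subspace e F oddF], assumption) (rule that)
  have contR: "continuous_on ?W R"
    using R(1) by (rule linear_continuous_on_compose [OF continuous_on_id])
  define r where "r = coords \<circ> R \<circ> from_coords"
  define g where "g = coords \<circ> G \<circ> from_coords"
  have contr: "continuous_map (nsphere ?k) (nsphere ?k) r"
    and contg: "continuous_map (nsphere ?k) (nsphere ?k) g"
    unfolding r_def g_def using continuous_map_nsphere_conjugate [OF k] contR R(2) G(1,2) by auto
  \<comment> \<open>\<open>deg r * deg r = 1\<close>, so the reflection has odd degree.\<close>
  have "(r \<circ> r) x = id x" if "x \<in> topspace (nsphere ?k)" for x
    using that by (simp add: r_def R(3) coords_from_coords_nsphere [OF k])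
  then have "Brouwer_degree2 ?k (r \<circ> r) = 1"
    using Brouwer_degree2_eq [of ?k "r \<circ> r" id] by simp
  then have r: "odd (Brouwer_degree2 ?k r)"
    using Brouwer_degree2_compose [OF contr contr] by (metis even_mult_iff odd_one)
  have "homotopic_with (\<lambda>_. True) (nsphere ?k) (nsphere ?k) (coords \<circ> ((R \<circ> F) \<circ> from_coords)) (coords \<circ> (G \<circ> from_coords))"
    by (rule homotopic_with_compose_continuous_map_left
        [OF homotopic_with_compose_continuous_map_right [OF hom continuous_map_from_coords [OF k]]
          continuous_map_coords [OF k]]) auto
  then have "Brouwer_degree2 ?k g = Brouwer_degree2 ?k (coords \<circ> ((R \<circ> F) \<circ> from_coords))"
    using Brouwer_degree2_homotopic by (metis g_def comp_assoc)
  also have "\<dots> = Brouwer_degree2 ?k (r \<circ> f)"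
    by (rule Brouwer_degree2_eq) (simp add: r_def F_def coords_from_coords_nsphere [OF k])
  also have "\<dots> = Brouwer_degree2 ?k r * Brouwer_degree2 ?k f"
    by (rule Brouwer_degree2_compose [OF Suc.prems(2) contr])
  finally have deg_g: "odd (Brouwer_degree2 ?k g) \<longleftrightarrow> odd (Brouwer_degree2 ?k f)"
    using r by simp
  have oddg: "g (\<lambda>i. - x i) = (\<lambda>i. - g x i)" if "x \<in> topspace (nsphere ?k)" for x
    using G(3) [OF from_coords_in_sphere [OF k that]] by (simp add: g_def from_coords_uminus coords_uminus)
  have sub: "x \<in> topspace (nsphere ?k) \<and> x ?k = 0" if "x \<in> topspace (nsphere n)" for x
    using that by (auto simp: topspace_nsphere_iff)
  have gn: "g x \<in> topspace (nsphere n)" if x: "x \<in> topspace (nsphere n)" for x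
  proof -
    have "from_coords x \<bullet> b ?k = 0"
      using sub [OF x] k by (simp add: from_coords_inner_b)
    then have "g x ?k = 0"
      using Geq from_coords_in_sphere [OF k] sub [OF x] k by (auto simp: g_def coords_def)
    moreover have "g x \<in> topspace (nsphere ?k)"
      using contg sub [OF x] by (auto simp: continuous_map_def)
    ultimately show ?thesis
      using topspace_nsphere_minus1 [of "g x" ?k] by simp
  qed
  have "continuous_map (nsphere n) (nsphere n) g"
  proof -
    have "continuous_map (subtopology (nsphere ?k) {x. x ?k = 0}) (subtopology (nsphere ?k) {x. x ?k = 0}) g"
    proof (rule continuous_map_into_subtopology [OF continuous_map_from_subtopology [OF contg]])
      show "g \<in> topspace (subtopology (nsphere ?k) {x. x ?k = 0}) \<rightarrow> {x. x ?k = 0}"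
        unfolding subtopology_nsphere_equator using gn sub by blast
    qed
    then show ?thesis
      by (simp only: subtopology_nsphere_equator)
  qed
  then have "odd (Brouwer_degree2 n g)"
    using Suc.IH [of g] oddg sub k by simp
  moreover have "even (Brouwer_degree2 ?k g - Brouwer_degree2 (?k - Suc 0) g)"
    by (rule Borsuk_odd_mapping_degree_step [OF contg]) (use oddg gn in auto)
  ultimately show ?case
    using deg_g by simp
qed

end

section \<open>The Borsuk-Ulam theorem\<close>

text \<open>If \<open>f\<close> had no zero, then normalising it and embedding its range isometrically would give an odd
self-map of the unit sphere that is not surjective. Such a map has degree zero, which is even.\<close>

theorem Borsuk_Ulam:
  fixes f :: "'a::euclidean_space \<Rightarrow> 'b::euclidean_space"
  assumes dim: "DIM('b) < DIM('a)"
    and contf: "continuous_on (sphere 0 1) f"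
    and oddf: "\<And>x. norm x = 1 \<Longrightarrow> f (- x) = - f x"
  obtains x where "norm x = 1" "f x = 0"
proof (rule ccontr)
  note zero_found = that
  assume no_zero: "\<not> thesis"
  have nz: "f x \<noteq> 0" if "norm x = 1" for x
    using no_zero zero_found [OF that] by blast
  obtain b :: "nat \<Rightarrow> 'a" where "bij_betw b {..<DIM('a)} Basis"
    using ex_bij_betw_nat_finite [OF finite_Basis] by (metis atLeast0LessThan)
  then interpret basis_enumeration b
    by unfold_locales
  define n where "n = DIM('a) - 1"
  have n: "n < DIM('a)"
    by (simp add: n_def)
  have coord_subspace_n: "coord_subspace n = UNIV"
    by (auto simp: coord_subspace_def n_def)
  obtain h :: "'b \<Rightarrow> 'a" where h: "linear h" "\<And>y. norm (h y) = norm y"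
    using isometry_subset_subspace [of "UNIV :: 'b set" "UNIV :: 'a set"] dim by auto
  define F where "F x = h (sgn (f x))" for x
  have F1: "norm (F x) = 1" if "norm x = 1" for x
    using nz [OF that] by (simp add: F_def h norm_sgn)
  have contF: "continuous_on (sphere 0 1) F"
    unfolding F_def
    by (intro linear_continuous_on_compose [OF _ h(1)] continuous_on_sgn contf) (simp add: nz)
  have oddF: "F (- x) = - F x" if "norm x = 1" for x
    using oddf [OF that] by (simp add: F_def sgn_minus linear_neg [OF h(1)])
  define g where "g = coords \<circ> F \<circ> from_coords"
  have contg: "continuous_map (nsphere n) (nsphere n) g"
    unfolding g_def using continuous_map_nsphere_conjugate [OF n] contF F1 by (auto simp: coord_subspace_n)
  have from_coords1: "norm (from_coords x) = 1" if "x \<in> topspace (nsphere n)" for x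
    using from_coords_in_sphere [OF n that] by simp
  have "odd (Brouwer_degree2 n g)"
    by (rule odd_nsphere_map_odd_degree [OF n contg])
      (simp add: g_def from_coords_uminus coords_uminus oddF from_coords1)
  moreover have "Brouwer_degree2 n g = 0"
  proof (rule Brouwer_degree2_nonsurjective [OF contg])
    have "dim (range h) < DIM('a)"
      using dim_image_le [OF h(1), of UNIV] dim by simp
    then obtain v where v: "v \<noteq> 0" "\<And>y. y \<in> span (range h) \<Longrightarrow> orthogonal v y"
      using orthogonal_to_subspace_exists by blast
    then have "sgn v \<bullet> F x = 0" for x
      by (simp add: F_def orthogonal_def span_base sgn_div_norm)
    moreover have "sgn v \<bullet> sgn v \<noteq> 0"
      using v(1) by (simp add: sgn_zero_iff)
    ultimately have "F x \<noteq> sgn v" for x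
      by metis
    moreover have "coords (sgn v) \<in> topspace (nsphere n)"
      using v(1) by (intro coords_in_nsphere [OF n]) (simp add: coord_subspace_n norm_sgn)
    moreover have "g x \<noteq> coords (sgn v)" for x
    proof
      assume "g x = coords (sgn v)"
      then have "from_coords (g x) = sgn v"
        by simp
      then show False
        using \<open>\<And>x. F x \<noteq> sgn v\<close> by (simp add: g_def)
    qed
    ultimately show "g ` topspace (nsphere n) \<noteq> topspace (nsphere n)"
      by (metis imageE)
  qed
  ultimately show False
    by simp
qed

section \<open>The excess of a set on one side of a hyperplane\<close>

text \<open>The pair \<open>w = (u, c)\<close> stands for the hyperplane \<open>u \<bullet> x = c\<close>. Admitting every \<open>w \<noteq> 0\<close>,
including \<open>u = 0\<close>, makes the space of parameters a full sphere, one dimension larger than the ambient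
unit sphere, on which the two orientations of a hyperplane are antipodal.\<close>

definition signed_excess :: "'a::euclidean_space set \<Rightarrow> 'a \<times> real \<Rightarrow> real" where
  "signed_excess E w = (LINT x:E|lebesgue. sgn (fst w \<bullet> x - snd w))"

lemma signed_excess_uminus: "signed_excess E (- w) = - signed_excess E w"
proof -
  have "sgn (fst (- w) \<bullet> x - snd (- w)) = - sgn (fst w \<bullet> x - snd w)" for x
    using sgn_minus [of "fst w \<bullet> x - snd w"] by simp
  then show ?thesis
    by (simp add: signed_excess_def set_lebesgue_integral_def)
qed

lemma signed_excess_cong:
  assumes "E \<in> sets lebesgue"
    and "\<And>x. x \<in> E \<Longrightarrow> sgn (fst v \<bullet> x - snd v) = sgn (fst w \<bullet> x - snd w)"
  shows "signed_excess E v = signed_excess E w"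
  unfolding signed_excess_def using assms by (intro set_lebesgue_integral_cong) auto

lemma signed_excess_one_sided:
  assumes "E \<in> lmeasurable" and "\<And>x. x \<in> E \<Longrightarrow> sgn (fst w \<bullet> x - snd w) = c"
  shows "signed_excess E w = c * measure lebesgue E"
proof -
  have "signed_excess E w = (LINT x:E|lebesgue. c)"
    unfolding signed_excess_def using assms by (intro set_lebesgue_integral_cong) auto
  then show ?thesis
    using assms(1) by (simp add: set_lebesgue_integral_def fmeasurable_def)
qed

lemma halfspaces_lmeasurable:
  assumes "E \<in> lmeasurable"
  shows "E \<inter> pos_halfspace u c \<in> lmeasurable" "E \<inter> neg_halfspace u c \<in> lmeasurable"
  using assms
  by (auto simp: pos_halfspace_def neg_halfspace_def open_halfspace_gt open_halfspace_lt
      intro!: fmeasurable_Int_fmeasurable borel_open)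

lemma signed_excess_eq:
  assumes E: "E \<in> lmeasurable"
  shows "signed_excess E (u, c) =
    measure lebesgue (E \<inter> pos_halfspace u c) - measure lebesgue (E \<inter> neg_halfspace u c)"
proof -
  let ?P = "E \<inter> pos_halfspace u c" and ?N = "E \<inter> neg_halfspace u c"
  have "signed_excess E (u, c) = (\<integral>x. indicat_real ?P x - indicat_real ?N x \<partial>lebesgue)"
    unfolding signed_excess_def set_lebesgue_integral_def
    by (intro Bochner_Integration.integral_cong)
      (auto simp: indicator_def pos_halfspace_def neg_halfspace_def sgn_if)
  also have "\<dots> = measure lebesgue ?P - measure lebesgue ?N"
    using halfspaces_lmeasurable [OF E, of u c]
    by (subst Bochner_Integration.integral_diff) (auto simp: fmeasurable_def)
  finally show ?thesis .
qed

lemma bisects_iff_signed_excess_eq_0: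
  assumes E: "E \<in> lmeasurable" and uc: "u \<noteq> 0 \<or> c \<noteq> 0"
  shows "bisects u c E \<longleftrightarrow> signed_excess E (u, c) = 0"
proof -
  let ?P = "E \<inter> pos_halfspace u c" and ?N = "E \<inter> neg_halfspace u c"
  have "negligible (E \<inter> hyperplane u c)"
    using negligible_hyperplane [OF uc] by (auto simp: hyperplane_def intro: negligible_subset)
  then have "measure lebesgue E = measure lebesgue (E - E \<inter> hyperplane u c)"
    using E by (subst measure_Diff_null_set) (auto simp: negligible_iff_null_sets)
  also have "E - E \<inter> hyperplane u c = ?P \<union> ?N"
    by (auto simp: hyperplane_def pos_halfspace_def neg_halfspace_def)
  also have "measure lebesgue \<dots> = measure lebesgue ?P + measure lebesgue ?N"
  proof -
    have "?P \<inter> ?N = {}"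
      by (auto simp: pos_halfspace_def neg_halfspace_def)
    then show ?thesis
      using measure_Un3 [OF halfspaces_lmeasurable [OF E, of u c]] by simp
  qed
  finally show ?thesis
    unfolding bisects_def signed_excess_eq [OF E] by auto
qed

lemma abs_signed_excess_le:
  assumes "E \<in> lmeasurable"
  shows "\<bar>signed_excess E w\<bar> \<le> measure lebesgue E"
proof -
  have "measure lebesgue (E \<inter> pos_halfspace (fst w) (snd w)) \<le> measure lebesgue E"
    "measure lebesgue (E \<inter> neg_halfspace (fst w) (snd w)) \<le> measure lebesgue E"
    using halfspaces_lmeasurable [OF assms] by (auto intro!: measure_mono_fmeasurable assms)
  then show ?thesis
    using signed_excess_eq [OF assms, of "fst w" "snd w", unfolded prod.collapse]
      measure_nonneg [of lebesgue "E \<inter> pos_halfspace (fst w) (snd w)"]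
      measure_nonneg [of lebesgue "E \<inter> neg_halfspace (fst w) (snd w)"] by linarith
qed

text \<open>By dominated convergence: the integrands converge at every point off the limiting hyperplane,
which is negligible (and empty if \<open>u = 0\<close>).\<close>

lemma signed_excess_tendsto:
  assumes E: "E \<in> lmeasurable" and lim: "W \<longlonglongrightarrow> w" and w: "w \<noteq> 0"
  shows "(\<lambda>k. signed_excess E (W k)) \<longlonglongrightarrow> signed_excess E w"
  unfolding signed_excess_def set_lebesgue_integral_def
proof (rule integral_dominated_convergence [where w = "indicat_real E"])
  have [measurable]: "E \<in> sets lebesgue"
    using E by auto
  have [measurable]: "(\<lambda>x. sgn (fst v \<bullet> x - snd v)) \<in> borel_measurable lebesgue" for v :: "'a \<times> real"
    by (intro measurable_completion) measurable
  show "(\<lambda>x. indicat_real E x *\<^sub>R sgn (fst w \<bullet> x - snd w)) \<in> borel_measurable lebesgue"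
    "(\<lambda>x. indicat_real E x *\<^sub>R sgn (fst (W k) \<bullet> x - snd (W k))) \<in> borel_measurable lebesgue" for k
    by measurable
  show "integrable lebesgue (indicat_real E)"
    using E by (auto simp: fmeasurable_def)
  show "AE x in lebesgue. norm (indicat_real E x *\<^sub>R sgn (fst (W k) \<bullet> x - snd (W k))) \<le> indicat_real E x" for k
    by (auto simp: indicator_def sgn_if)
  have "negligible {x. fst w \<bullet> x = snd w}"
    using w by (intro negligible_hyperplane) (auto simp: prod_eq_iff)
  then have "AE x in lebesgue. x \<notin> {x. fst w \<bullet> x = snd w}"
    by (intro AE_not_in) (simp add: negligible_iff_null_sets)
  then show "AE x in lebesgue. (\<lambda>k. indicat_real E x *\<^sub>R sgn (fst (W k) \<bullet> x - snd (W k)))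
      \<longlonglongrightarrow> indicat_real E x *\<^sub>R sgn (fst w \<bullet> x - snd w)"
    by eventually_elim (auto intro!: tendsto_intros tendsto_sgn lim)
qed

lemma continuous_on_signed_excess:
  assumes "E \<in> lmeasurable" "0 \<notin> S"
  shows "continuous_on S (signed_excess E)"
  unfolding continuous_on_sequentially o_def
  using signed_excess_tendsto [OF assms(1)] assms(2) by metis

section \<open>The ham sandwich theorem with contact\<close>

text \<open>The form of the Borsuk-Ulam theorem that fits one real function for each of the \<open>DIM('a)\<close> sets:
the coordinates of a map into \<open>'a\<close>.\<close>

lemma odd_functions_common_zero:
  fixes d :: "nat \<Rightarrow> 'a::euclidean_space \<times> real \<Rightarrow> real"
  assumes contd: "\<And>i. i < DIM('a) \<Longrightarrow> continuous_on (sphere 0 1) (d i)"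
    and oddd: "\<And>i w. i < DIM('a) \<Longrightarrow> norm w = 1 \<Longrightarrow> d i (- w) = - d i w"
  obtains w where "norm w = 1" "\<And>i. i < DIM('a) \<Longrightarrow> d i w = 0"
proof -
  obtain b :: "nat \<Rightarrow> 'a" where "bij_betw b {..<DIM('a)} Basis"
    using ex_bij_betw_nat_finite [OF finite_Basis] by (metis atLeast0LessThan)
  then interpret basis_enumeration b
    by unfold_locales
  define f where "f w = (\<Sum>i<DIM('a). d i w *\<^sub>R b i)" for w
  have "DIM('a) < DIM('a \<times> real)"
    by simp
  moreover have "continuous_on (sphere 0 1) f"
    unfolding f_def by (intro continuous_intros contd) simp
  moreover have "f (- w) = - f w" if "norm w = 1" for w
    using that by (simp add: f_def oddd sum_negf)
  ultimately obtain w where w: "norm w = 1" "f w = 0"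
    by (rule Borsuk_Ulam)
  have "d i w = 0" if "i < DIM('a)" for i
    using from_coords_inner_b [OF that, of "\<lambda>i. d i w"] w(2) by (simp add: f_def from_coords_def)
  with w(1) that show thesis
    by blast
qed

lemma sgn_eq_of_close: "sgn y = sgn z" if "\<bar>y - z\<bar> < \<bar>z\<bar>" for y z :: real
  using that by (auto simp: sgn_if)

lemma affine_functional_diff_le:
  fixes x :: "'a::euclidean_space"
  shows "\<bar>(fst v \<bullet> x - snd v) - (fst w \<bullet> x - snd w)\<bar> \<le> norm (v - w) * (norm x + 1)"
proof -
  have "(fst v \<bullet> x - snd v) - (fst w \<bullet> x - snd w) = fst (v - w) \<bullet> x - snd (v - w)"
    by (simp add: inner_diff_left)
  also have "\<bar>\<dots>\<bar> \<le> norm (fst (v - w)) * norm x + norm (snd (v - w))"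
    using Cauchy_Schwarz_ineq2 [of "fst (v - w)" x] by (simp del: fst_diff snd_diff)
  also have "\<dots> \<le> norm (v - w) * norm x + norm (v - w)"
    using norm_fst_le [of "fst (v - w)" "snd (v - w)"] norm_snd_le [of "snd (v - w)" "fst (v - w)"]
    unfolding prod.collapse by (intro add_mono mult_right_mono) auto
  finally show ?thesis
    by (simp add: algebra_simps)
qed

text \<open>This is the reason for bisecting \<open>A\<close> together with a small ball about one of its points. If the
limit hyperplane missed the closure of \<open>A\<close>, it would keep a positive distance from it; then the
hyperplanes \<open>W k\<close> for large \<open>k\<close> would split \<open>A\<close> exactly as the limit does, that is, in equal
parts. The balls would have to be bisected as well, although for large \<open>k\<close> they lie on one side.\<close>

lemma limit_hyperplane_meets_closure:
  fixes A :: "'a::euclidean_space set"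
  assumes A: "A \<in> lmeasurable" "bounded A" "a \<in> A"
    and lim: "W \<longlonglongrightarrow> w" and rho: "\<rho> \<longlonglongrightarrow> 0" "\<And>k. \<rho> k > 0"
    and W: "\<And>k. signed_excess A (W k) + signed_excess (ball a (\<rho> k)) (W k) = 0"
    and w: "signed_excess A w = 0"
  shows "hyperplane (fst w) (snd w) \<inter> closure A \<noteq> {}"
proof
  assume disj: "hyperplane (fst w) (snd w) \<inter> closure A = {}"
  define h where "h v x = fst v \<bullet> x - snd v" for v and x :: 'a
  have "compact (closure A)" "closure A \<noteq> {}"
    using A by auto
  moreover have "continuous_on (closure A) (\<lambda>x. \<bar>h w x\<bar>)"
    unfolding h_def by (intro continuous_intros)
  ultimately have "\<exists>z\<in>closure A. \<forall>x\<in>closure A. \<bar>h w z\<bar> \<le> \<bar>h w x\<bar>"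
    by (rule continuous_attains_inf)
  then obtain z where z: "z \<in> closure A" "\<And>x. x \<in> closure A \<Longrightarrow> \<bar>h w z\<bar> \<le> \<bar>h w x\<bar>"
    by blast
  define \<delta> where "\<delta> = \<bar>h w z\<bar>"
  have \<delta>: "\<delta> > 0" "\<And>x. x \<in> A \<Longrightarrow> \<delta> \<le> \<bar>h w x\<bar>"
    using z disj closure_subset [of A] by (auto simp: \<delta>_def h_def hyperplane_def)
  obtain M where M: "\<And>x. x \<in> A \<Longrightarrow> norm x \<le> M"
    using A(2) by (auto simp: bounded_iff)
  have "(\<lambda>k. norm (W k - w) * (M + 1)) \<longlonglongrightarrow> 0"
    by (rule tendsto_mult_left_zero [OF tendsto_norm_zero [OF LIM_zero [OF lim]]])
  then have "\<forall>\<^sub>F k in sequentially. norm (W k - w) * (M + 1) < \<delta> / 2"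
    by (rule order_tendstoD) (use \<delta> in simp)
  moreover have "(\<lambda>k. norm (fst (W k)) * \<rho> k) \<longlonglongrightarrow> 0"
    using tendsto_mult [OF tendsto_norm [OF tendsto_fst [OF lim]] rho(1)] by simp
  then have "\<forall>\<^sub>F k in sequentially. norm (fst (W k)) * \<rho> k < \<delta> / 2"
    by (rule order_tendstoD) (use \<delta> in simp)
  ultimately have "\<forall>\<^sub>F k in sequentially. False"
  proof eventually_elim
    case (elim k)
    have close: "\<bar>h (W k) x - h w x\<bar> < \<delta> / 2" if "x \<in> A" for x
    proof -
      have "\<bar>h (W k) x - h w x\<bar> \<le> norm (W k - w) * (norm x + 1)"
        unfolding h_def by (rule affine_functional_diff_le)
      also have "\<dots> \<le> norm (W k - w) * (M + 1)"
        using M [OF that] by (intro mult_left_mono) auto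
      finally show ?thesis
        using elim(1) by simp
    qed
    have "sgn (h (W k) x) = sgn (h w x)" if "x \<in> A" for x
      using close [OF that] \<delta>(2) [OF that] \<delta>(1) by (intro sgn_eq_of_close) linarith
    then have "signed_excess A (W k) = signed_excess A w"
      using A(1) by (intro signed_excess_cong) (auto simp: h_def)
    with W [of k] w have "signed_excess (ball a (\<rho> k)) (W k) = 0"
      by simp
    moreover have "sgn (h (W k) x) = sgn (h w a)" if "x \<in> ball a (\<rho> k)" for x
    proof (rule sgn_eq_of_close)
      have "\<bar>h (W k) x - h (W k) a\<bar> = \<bar>fst (W k) \<bullet> (x - a)\<bar>"
        by (simp add: h_def inner_diff_right)
      also have "\<dots> \<le> norm (fst (W k)) * norm (x - a)"
        by (rule Cauchy_Schwarz_ineq2)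
      also have "\<dots> \<le> norm (fst (W k)) * \<rho> k"
        using that by (intro mult_left_mono) (auto simp: dist_norm norm_minus_commute)
      finally show "\<bar>h (W k) x - h w a\<bar> < \<bar>h w a\<bar>"
        using elim(2) close [OF A(3)] \<delta>(2) [OF A(3)] by linarith
    qed
    then have "signed_excess (ball a (\<rho> k)) (W k) = sgn (h w a) * measure lebesgue (ball a (\<rho> k))"
      by (intro signed_excess_one_sided) (auto simp: h_def)
    moreover have "measure lebesgue (ball a (\<rho> k)) > 0"
      using rho(2) by (simp add: content_ball_pos)
    ultimately show False
      using \<delta>(1) \<delta>(2) [OF A(3)] by (auto simp: sgn_if split: if_splits)
  qed
  then show False
    by simp
qed

text \<open>The usual ham sandwich argument applied to \<open>A i\<close> with an additional ball of radius \<open>\<rho> k\<close>,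
whose measure is counted on top of that of \<open>A i\<close>. A limit of the resulting parameters bisects
the sets \<open>A i\<close> themselves, because the balls shrink to measure zero, and it inherits the contact with
their closures from \<open>limit_hyperplane_meets_closure\<close>.\<close>

theorem ham_sandwich_meeting_closures:
  fixes A :: "nat \<Rightarrow> 'a::euclidean_space set"
  assumes bdd: "\<And>i. i < DIM('a) \<Longrightarrow> bounded (A i)"
    and meas: "\<And>i. i < DIM('a) \<Longrightarrow> A i \<in> lmeasurable"
    and pos: "\<And>i. i < DIM('a) \<Longrightarrow> measure lebesgue (A i) > 0"
  obtains u c where "u \<noteq> 0"
    "\<And>i. i < DIM('a) \<Longrightarrow> bisects u c (A i) \<and> hyperplane u c \<inter> closure (A i) \<noteq> {}"
proof -
  have "\<exists>a. a \<in> A i" if "i < DIM('a)" for i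
    using pos [OF that] by (metis all_not_in_conv less_irrefl measure_empty)
  then obtain a where a: "\<And>i. i < DIM('a) \<Longrightarrow> a i \<in> A i"
    by metis
  define \<rho> where "\<rho> k = inverse (real (Suc k))" for k
  have "\<exists>w. norm w = 1 \<and> (\<forall>i<DIM('a). signed_excess (A i) w + signed_excess (ball (a i) (\<rho> k)) w = 0)" for k
    by (rule odd_functions_common_zero
        [of "\<lambda>i w. signed_excess (A i) w + signed_excess (ball (a i) (\<rho> k)) w"])
      (auto intro!: continuous_intros continuous_on_signed_excess meas simp: signed_excess_uminus)
  then obtain W where W: "\<And>k. norm (W k) = 1"
    "\<And>k i. i < DIM('a) \<Longrightarrow> signed_excess (A i) (W k) + signed_excess (ball (a i) (\<rho> k)) (W k) = 0"
    by metis
  obtain w r where w: "w \<in> sphere 0 1" and r: "strict_mono r" "(W \<circ> r) \<longlonglongrightarrow> w"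
    using compact_sphere [of 0 1] W(1) unfolding compact_def by (metis mem_sphere_0)
  have w0: "w \<noteq> 0"
    using w by auto
  have \<rho>: "(\<rho> \<circ> r) \<longlonglongrightarrow> 0"
    using LIMSEQ_subseq_LIMSEQ [OF LIMSEQ_inverse_real_of_nat r(1)] by (simp add: \<rho>_def o_def)
  have zero: "signed_excess (A i) w = 0" if i: "i < DIM('a)" for i
  proof (rule LIMSEQ_unique)
    show "(\<lambda>k. signed_excess (A i) ((W \<circ> r) k)) \<longlonglongrightarrow> signed_excess (A i) w"
      by (rule signed_excess_tendsto [OF meas [OF i] r(2) w0])
    show "(\<lambda>k. signed_excess (A i) ((W \<circ> r) k)) \<longlonglongrightarrow> 0"
    proof (rule Lim_null_comparison)
      have "\<bar>signed_excess (A i) ((W \<circ> r) k)\<bar> \<le> unit_ball_vol (DIM('a)) * (\<rho> \<circ> r) k ^ DIM('a)" for k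
      proof -
        have "\<bar>signed_excess (A i) (W (r k))\<bar> = \<bar>signed_excess (ball (a i) (\<rho> (r k))) (W (r k))\<bar>"
          using W(2) [OF i, of "r k"] by linarith
        also have "\<dots> \<le> measure lebesgue (ball (a i) (\<rho> (r k)))"
          by (rule abs_signed_excess_le) simp
        also have "\<dots> = unit_ball_vol (DIM('a)) * \<rho> (r k) ^ DIM('a)"
          by (simp add: content_ball \<rho>_def)
        finally show ?thesis
          by simp
      qed
      then show "\<forall>\<^sub>F k in sequentially. norm (signed_excess (A i) ((W \<circ> r) k))
          \<le> unit_ball_vol (DIM('a)) * (\<rho> \<circ> r) k ^ DIM('a)"
        by simp
      show "(\<lambda>k. unit_ball_vol (DIM('a)) * (\<rho> \<circ> r) k ^ DIM('a)) \<longlonglongrightarrow> 0"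
        by (intro tendsto_mult_right_zero tendsto_null_power \<rho>) simp
    qed
  qed
  show thesis
  proof
    show "fst w \<noteq> 0"
    proof
      \<comment> \<open>All of \<open>A 0\<close> would lie on one side of the degenerate hyperplane, so it is not bisected.\<close>
      assume "fst w = 0"
      then have "signed_excess (A 0) w = sgn (- snd w) * measure lebesgue (A 0)"
        by (intro signed_excess_one_sided meas) auto
      then show False
        using zero [of 0] pos [of 0] w0 \<open>fst w = 0\<close> by (auto simp: prod_eq_iff sgn_zero_iff)
    qed
    then show "bisects (fst w) (snd w) (A i) \<and> hyperplane (fst w) (snd w) \<inter> closure (A i) \<noteq> {}"
      if i: "i < DIM('a)" for i
      using bisects_iff_signed_excess_eq_0 [OF meas [OF i], of "fst w" "snd w"] zero [OF i]
        limit_hyperplane_meets_closure [OF meas [OF i] bdd [OF i] a [OF i] r(2) \<rho>] W(2) [OF i]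
      by (simp add: \<rho>_def)
  qed
qed

lemma scaled_hyperplane:
  fixes u :: "'a::euclidean_space"
  assumes "t \<noteq> 0"
  shows "hyperplane (t *\<^sub>R u) (t * c) = hyperplane u c"
    and "bisects (t *\<^sub>R u) (t * c) E \<longleftrightarrow> bisects u c E"
proof -
  show "hyperplane (t *\<^sub>R u) (t * c) = hyperplane u c"
    using assms by (simp add: hyperplane_def)
  have "pos_halfspace (t *\<^sub>R u) (t * c) = (if t > 0 then pos_halfspace u c else neg_halfspace u c)"
    "neg_halfspace (t *\<^sub>R u) (t * c) = (if t > 0 then neg_halfspace u c else pos_halfspace u c)"
    using assms by (auto simp: pos_halfspace_def neg_halfspace_def mult_less_cancel_left)
  then show "bisects (t *\<^sub>R u) (t * c) E \<longleftrightarrow> bisects u c E"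
    by (auto simp: bisects_def)
qed

theorem corollary7:
  fixes A :: "nat \<Rightarrow> (real ^ 'n) set"
  assumes "\<And>i. i \<in> {1..CARD('n)} \<Longrightarrow> bounded (A i)"
    and "\<And>i. i \<in> {1..CARD('n)} \<Longrightarrow> A i \<in> sets borel"
    and "\<And>i. i \<in> {1..CARD('n)} \<Longrightarrow> measure lebesgue (A i) > 0"
  shows "\<exists>u c. norm u = 1 \<and> c \<ge> 0 \<and>
           (\<forall>i\<in>{1..CARD('n)}. bisects u c (A i) \<and> hyperplane u c \<inter> closure (A i) \<noteq> {})"
proof -
  have meas: "A i \<in> lmeasurable" if "i \<in> {1..CARD('n)}" for i
    using assms(1,2) [OF that] by (intro bounded_set_imp_lmeasurable) auto
  obtain u c where u: "u \<noteq> 0"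
    and uc: "\<And>i. i < DIM(real ^ 'n) \<Longrightarrow>
      bisects u c (A (Suc i)) \<and> hyperplane u c \<inter> closure (A (Suc i)) \<noteq> {}"
    by (rule ham_sandwich_meeting_closures [of "\<lambda>i. A (Suc i)"]) (auto intro: assms meas)
  \<comment> \<open>The scaling normalises \<open>u\<close> and its sign makes the offset nonnegative.\<close>
  define t where "t = (if c \<ge> 0 then 1 else - 1) / norm u"
  have t: "t \<noteq> 0" "norm (t *\<^sub>R u) = 1" "t * c \<ge> 0"
    using u by (auto simp: t_def divide_nonpos_nonneg)
  have "bisects (t *\<^sub>R u) (t * c) (A i) \<and> hyperplane (t *\<^sub>R u) (t * c) \<inter> closure (A i) \<noteq> {}"
    if "i \<in> {1..CARD('n)}" for i
  proof -
    have "i - 1 < DIM(real ^ 'n)" "Suc (i - 1) = i"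
      using that by auto
    with uc [of "i - 1"] show ?thesis
      using t(1) by (simp add: scaled_hyperplane)
  qed
  with t(2,3) show ?thesis
    by blast
qed

end
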